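(* Let $(\mathbb V,\|\cdot\|_{\mathbb V})$ be a Hilbert space, $V_{h,1},\dots,V_{h,n}\subset\mathbb V$ finite-dimensional subspaces, $V_h=V_{h,1}+\dots+V_{h,n}$, let $\mathbb V_0\subset\mathbb V$ be a closed subspace, $\mathbb X=\mathbb V/\mathbb V_0$ with canonical surjection $T:\mathbb V\to\mathbb X$ and quotient norm $\|\cdot\|_{\mathbb X}$, and set $X_{h,i}=T(V_{h,i})$, $X_h=T(V_h)=X_{h,1}+\dots+X_{h,n}$. Let $\alpha_h,A_h>0$ be such that $$\forall u_h\in V_h,\qquad\alpha_h\|u_h\|_{\mathbb V}^2\le|||u_h|||_{\mathbb V}^2\le A_h\|u_h\|_{\mathbb V}^2.$$ Assume: (A) there exists an operator $\Pi_h:\mathbb V\to\mathbb V$ which is a (bounded linear) projection onto $V_h$ (i.e. $\Pi_hu_h=u_h$ for $u_h\in V_h$) and which preserves $\mathbb V_0$ (i.e. $v\in\mathbb V_0$ implies $\Pi_hv\in\mathbb V_0$); denote by $\|\Pi_h\|_{\mathcal L(\mathbb V)}$ its operator norm; (B) there exist constants $\kappa_1,\dots,\kappa_n>0$ such that for every $i$ and all $u_{h,i}\in V_{h,i}$, $$\min\{\|u_{h,i}-u_{h,i,0}\|_{\mathbb V}:u_{h,i,0}\in\mathbb V_0\cap V_{h,i}\}\le\kappa_i\min\{\|u_{h,i}-u_{h,0}\|_{\mathbb V}:u_{h,0}\in\mathbb V_0\cap V_h\}.$$ Then $$\forall f_h\in X_h,\qquad\beta_h\|f_h\|_{\mathbb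 X}^2\le|||f_h|||_{\mathbb X}^2\le B_h\|f_h\|_{\mathbb X}^2,$$ with $$\beta_h=\frac{\alpha_h}{(\max_{1\le i\le n}\kappa_i)^2\|\Pi_h\|^2_{\mathcal L(\mathbb V)}},\qquad B_h=\|\Pi_h\|^2_{\mathcal L(\mathbb V)}A_h.$$
   Context: The splitting norms are $$|||u_h|||_{\mathbb V}^2=\inf\Big\{\sum_{i=1}^n\|u_{h,i}\|_{\mathbb V}^2:\sum_{i=1}^nu_{h,i}=u_h,\ u_{h,i}\in V_{h,i}\Big\},\quad u_h\in V_h,$$ $$|||f_h|||_{\mathbb X}^2=\inf\Big\{\sum_{i=1}^n\|f_{h,i}\|_{\mathbb X}^2:\sum_{i=1}^nf_{h,i}=f_h,\ f_{h,i}\in X_{h,i}\Big\},\quad f_h\in X_h,$$ and the quotient norm is $\|x\|_{\mathbb X}=\inf_{v\in T^{-1}(x)}\|v\|_{\mathbb V}$. *)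

theory Defs
  imports "HOL-Analysis.Analysis"
begin

definition finite_dim_subspace :: "'a::real_vector set \<Rightarrow> bool" where
  "finite_dim_subspace S \<longleftrightarrow> subspace S \<and> (\<exists>B. finite B \<and> S = span B)"

text \<open>
  The quotient of a vector space by \<open>V0\<close> is represented by the cosets \<open>v +o V0\<close>;
  its carrier is \<open>range (canonical_surj V0)\<close> and its addition is the addition of sets from
  \<^theory>\<open>HOL-Library.Set_Algebras\<close>. The neutral element of set addition is \<open>{0}\<close>, whereas the
  zero of the quotient is \<open>V0\<close>; sums of cosets over nonempty index sets are nevertheless the
  sums of the quotient space, see \<open>canonical_surj_sum\<close> below.
\<close>

definition canonical_surj :: "'a::real_vector set \<Rightarrow> 'a \<Rightarrow> 'a set" where
  "canonical_surj V0 v = v +o V0"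

definition quotient_norm :: "'a::real_normed_vector set \<Rightarrow> 'a set \<Rightarrow> real" where
  "quotient_norm V0 x = (INF v \<in> canonical_surj V0 -` {x}. norm v)"

text \<open>
  \<open>splitting_norm N n S u\<close> is the splitting norm of \<open>u\<close> with respect to the subspaces
  \<open>S 1, \<dots>, S n\<close>, where \<open>N\<close> is the norm of the ambient space. The ambient space is only required to
  be a commutative monoid, so that the definition applies both to a vector space and to
  the cosets of a subspace of it.
\<close>

definition splitting_norm ::
  "('b::comm_monoid_add \<Rightarrow> real) \<Rightarrow> nat \<Rightarrow> (nat \<Rightarrow> 'b set) \<Rightarrow> 'b \<Rightarrow> real" where
  "splitting_norm N n S u =
     sqrt (Inf {\<Sum>i=1..n. (N (w i))\<^sup>2 | w. (\<Sum>i=1..n. w i) = u \<and> (\<forall>i\<in>{1..n}. w i \<in> S i)})"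

text \<open>
  The minimum of \<open>\<parallel>u - w\<parallel>\<close> over \<open>w \<in> S\<close>. It is attained if \<open>S\<close> is a finite-dimensional
  subspace, see \<open>min_dist_attained\<close> below.
\<close>

definition min_dist :: "'a::real_normed_vector set \<Rightarrow> 'a \<Rightarrow> real" where
  "min_dist S u = (LEAST r. \<exists>w\<in>S. r = norm (u - w))"

lemma canonical_surj_add:
  assumes "subspace V0"
  shows "canonical_surj V0 (u + v) = canonical_surj V0 u + canonical_surj V0 v"
proof -
  have "V0 + V0 = V0"
    using assms subspace_0[OF assms]
    by (force simp: set_plus_def subspace_add)
  then show ?thesis
    unfolding canonical_surj_def by (simp add: set_plus_rearrange)
qed

lemma canonical_surj_sum:
  assumes "subspace V0" "finite I" "I \<noteq> {}"
  shows "canonical_surj V0 (\<Sum>i\<in>I. v i) = (\<Sum>i\<in>I. canonical_surj V0 (v i))"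
  using assms(2,3)
  by (induction I rule: finite_ne_induct) (simp_all add: canonical_surj_add[OF assms(1)])

lemma splitting_norm_sq:
  assumes "\<exists>w. (\<Sum>i=1..n. w i) = u \<and> (\<forall>i\<in>{1..n}. w i \<in> S i)"
  shows "(splitting_norm N n S u)\<^sup>2 =
    Inf {\<Sum>i=1..n. (N (w i))\<^sup>2 | w. (\<Sum>i=1..n. w i) = u \<and> (\<forall>i\<in>{1..n}. w i \<in> S i)}"
proof -
  have "0 \<le> Inf {\<Sum>i=1..n. (N (w i))\<^sup>2 | w. (\<Sum>i=1..n. w i) = u \<and> (\<forall>i\<in>{1..n}. w i \<in> S i)}"
    using assms by (intro cInf_greatest) (auto intro!: sum_nonneg)
  then show ?thesis
    by (simp add: splitting_norm_def)
qed

lemma min_dist_attained: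
  fixes S :: "'a::real_inner set"
  assumes "finite_dim_subspace S"
  shows "\<exists>w\<in>S. min_dist S u = norm (u - w) \<and> (\<forall>w'\<in>S. norm (u - w) \<le> norm (u - w'))"
proof -
  obtain B where B: "finite B" "S = span B"
    using assms by (auto simp: finite_dim_subspace_def)
  obtain C where C: "finite C" "span C = S" "pairwise orthogonal C"
    using basis_orthogonal[OF B(1)] B(2) by blast
  define p where "p = (\<Sum>c\<in>C. (c \<bullet> u / (c \<bullet> c)) *\<^sub>R c)"
  have pS: "p \<in> S"
    unfolding p_def C(2)[symmetric] by (intro span_sum span_mul span_base)
  have orth_C: "orthogonal (u - p) c" if c: "c \<in> C" for c
  proof -
    have "p \<bullet> c = (\<Sum>d\<in>C. if d = c then c \<bullet> u else 0)"
      unfolding p_def inner_sum_left using C(3) c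
      by (intro sum.cong) (auto simp: pairwise_def orthogonal_def)
    also have "\<dots> = c \<bullet> u"
      using C(1) c by simp
    finally show ?thesis
      by (simp add: orthogonal_def inner_diff_left inner_commute[of c u])
  qed
  have orth_S: "orthogonal (u - p) x" if "x \<in> S" for x
    using orthogonal_to_span[of x C "u - p"] that orth_C C(2) by blast
  have least: "norm (u - p) \<le> norm (u - w)" if "w \<in> S" for w
  proof -
    have "p - w \<in> S"
      using pS that assms by (simp add: finite_dim_subspace_def subspace_diff)
    then have "(norm ((u - p) + (p - w)))\<^sup>2 = (norm (u - p))\<^sup>2 + (norm (p - w))\<^sup>2"
      by (intro norm_add_Pythagorean orth_S)
    then have "(norm (u - p))\<^sup>2 \<le> (norm (u - w))\<^sup>2"
      by simp
    then show ?thesis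
      by (rule power2_le_imp_le) simp
  qed
  have "min_dist S u = norm (u - p)"
    unfolding min_dist_def by (rule Least_equality) (use pS least in auto)
  with pS least show ?thesis
    by blast
qed

end

theory Submission
  imports Defs
begin

text \<open>
  Write \<open>q\<close> for the quotient norm, \<open>T\<close> for the canonical surjection and \<open>K\<close> for the maximum of
  the \<open>\<kappa> i\<close>. The point is that the distance from \<open>u \<in> Vh\<close> to \<open>V0 \<inter> Vh\<close> is comparable to its
  distance \<open>q (T u)\<close> to all of \<open>V0\<close>: if \<open>w \<in> V0\<close>, then \<open>P w \<in> V0 \<inter> Vh\<close> and
  \<open>u + P w = P (u + w)\<close>, so that \<open>min_dist (V0 \<inter> Vh) u \<le> onorm P * q (T u)\<close>
  (lemma \<open>min_dist_le_quotient_norm\<close>). Both estimates are then transferred from \<open>Vh\<close> by lifting.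

  For the upper bound, \<open>f\<close> is lifted to the \<open>u \<in> Vh\<close> of least norm, which satisfies
  \<open>norm u \<le> onorm P * q f\<close>; since \<open>T\<close> does not increase norms, every splitting of \<open>u\<close> is mapped
  to a splitting of \<open>f\<close> that costs no more, and the splitting norm of \<open>u\<close> is controlled by \<open>A\<close>.

  For the lower bound, let \<open>f\<close> be the sum of \<open>f i\<close>. Each \<open>f i\<close> is lifted to the \<open>u i \<in> V i\<close> of
  least norm; the hypothesis on \<open>\<kappa>\<close> gives \<open>norm (u i) \<le> K * onorm P * q (f i)\<close>. The sum \<open>u\<close> of
  the \<open>u i\<close> is a lift of \<open>f\<close>, whence
  \<open>\<alpha> * (q f)\<^sup>2 \<le> \<alpha> * (norm u)\<^sup>2 \<le> (\<Sum>i. (norm (u i))\<^sup>2) \<le> (K * onorm P)\<^sup>2 * (\<Sum>i. (q (f i))\<^sup>2)\<close>.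
\<close>

section \<open>Finite-dimensional subspaces\<close>

lemma finite_dim_subspace_subset:
  assumes "subspace S" "S \<subseteq> span B" "finite B"
  shows "finite_dim_subspace S"
proof -
  obtain C where C: "C \<subseteq> S" "independent C" "S \<subseteq> span C"
    using maximal_independent_subset[of S] by blast
  have "finite C"
    using independent_span_bound[OF assms(3) C(2)] C(1) assms(2) by auto
  moreover have "S = span C"
    using C span_minimal[OF C(1) assms(1)] by blast
  ultimately show ?thesis
    using assms(1) by (auto simp: finite_dim_subspace_def)
qed

lemma finite_dim_subspace_Int:
  assumes "subspace S" "finite_dim_subspace U"
  shows "finite_dim_subspace (S \<inter> U)"
proof -
  obtain B where "finite B" "U = span B"
    using assms(2) by (auto simp: finite_dim_subspace_def)
  then show ?thesis
    using assms by (intro finite_dim_subspace_subset[of _ B])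
      (auto simp: finite_dim_subspace_def intro: subspace_inter)
qed

lemma finite_dim_subspace_sum:
  assumes "finite I" "\<And>i. i \<in> I \<Longrightarrow> finite_dim_subspace (V i)"
  shows "finite_dim_subspace (\<Sum>i\<in>I. V i)"
  using assms
proof (induction I rule: finite_induct)
  case empty
  show ?case
    by (auto simp: finite_dim_subspace_def set_zero intro!: exI[of _ "{}"])
next
  case (insert j I)
  obtain B C where "finite B" "V j = span B" "finite C" "(\<Sum>i\<in>I. V i) = span C"
    using insert by (force simp: finite_dim_subspace_def)
  then have "(\<Sum>i\<in>insert j I. V i) = span (B \<union> C)"
    using insert by (auto simp: span_Un set_plus_def)
  with \<open>finite B\<close> \<open>finite C\<close> show ?case
    unfolding finite_dim_subspace_def by (metis finite_UnI subspace_span)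
qed

lemma mem_set_sum_iff:
  fixes V :: "'i \<Rightarrow> 'b::comm_monoid_add set"
  assumes "finite I"
  shows "u \<in> (\<Sum>i\<in>I. V i) \<longleftrightarrow> (\<exists>w. (\<Sum>i\<in>I. w i) = u \<and> (\<forall>i\<in>I. w i \<in> V i))"
  using assms by (auto simp: set_sum_alt)

section \<open>The quotient norm and minimal lifts\<close>

lemma canonical_surj_eq_iff:
  assumes "subspace V0"
  shows "canonical_surj V0 u = canonical_surj V0 v \<longleftrightarrow> u - v \<in> V0"
proof
  assume eq: "canonical_surj V0 u = canonical_surj V0 v"
  have "u \<in> canonical_surj V0 u"
    using subspace_0[OF assms] by (force simp: canonical_surj_def elt_set_plus_def)
  with eq show "u - v \<in> V0"
    by (auto simp: canonical_surj_def elt_set_plus_def)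
next
  assume "u - v \<in> V0"
  then have "canonical_surj V0 (u - v) = V0"
    unfolding canonical_surj_def elt_set_plus_def
    using assms subspace_add[OF assms] subspace_diff[OF assms]
    by (auto intro: bexI[of _ "_ - (u - v)"])
  moreover have "u +o V0 = v +o ((u - v) +o V0)"
    by (simp add: set_plus_rearrange2)
  ultimately show "canonical_surj V0 u = canonical_surj V0 v"
    by (simp add: canonical_surj_def)
qed

lemma quotient_norm_le_norm:
  "quotient_norm V0 (canonical_surj V0 v) \<le> norm v"
  unfolding quotient_norm_def
  by (intro cINF_lower) (auto intro!: bdd_belowI[of _ 0])

lemma le_quotient_norm:
  assumes "subspace V0" "\<And>w. w \<in> V0 \<Longrightarrow> c \<le> norm (v + w)"
  shows "c \<le> quotient_norm V0 (canonical_surj V0 v)"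
  unfolding quotient_norm_def
proof (rule cINF_greatest)
  show "canonical_surj V0 -` {canonical_surj V0 v} \<noteq> {}"
    by auto
  fix u assume "u \<in> canonical_surj V0 -` {canonical_surj V0 v}"
  then have "u - v \<in> V0"
    by (simp add: canonical_surj_eq_iff[OF assms(1)])
  from assms(2)[OF this] show "c \<le> norm u"
    by simp
qed

lemma quotient_norm_nonneg:
  assumes "subspace V0"
  shows "0 \<le> quotient_norm V0 (canonical_surj V0 v)"
  by (rule le_quotient_norm[OF assms]) simp

text \<open>
  If an operator with values in \<open>U\<close> preserves \<open>V0\<close>, then the distance of each of its fixed points
  to \<open>V0 \<inter> U\<close> is at most its norm times the distance to \<open>V0\<close>. For a projection onto \<open>U\<close>, the fixed
  points are all of \<open>U\<close>.
\<close>

lemma min_dist_le_quotient_norm: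
  fixes P :: "'a::real_inner \<Rightarrow> 'a"
  assumes V0: "subspace V0" and fd: "finite_dim_subspace (V0 \<inter> U)"
    and P: "bounded_linear P" "range P \<subseteq> U" "\<And>v. v \<in> V0 \<Longrightarrow> P v \<in> V0"
    and u: "P u = u"
  shows "min_dist (V0 \<inter> U) u \<le> onorm P * quotient_norm V0 (canonical_surj V0 u)"
proof -
  interpret P: bounded_linear P by fact
  have *: "min_dist (V0 \<inter> U) u \<le> onorm P * norm (u + w)" if w: "w \<in> V0" for w
  proof -
    have "P (- w) \<in> V0 \<inter> U"
      using w P(2,3) subspace_neg[OF V0] by blast
    then have "min_dist (V0 \<inter> U) u \<le> norm (u - P (- w))"
      using min_dist_attained[OF fd, of u] by auto
    also have "u - P (- w) = P (u + w)"
      by (simp add: P.add P.neg u)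
    also have "norm \<dots> \<le> onorm P * norm (u + w)"
      by (rule onorm[OF P(1)])
    finally show ?thesis .
  qed
  show ?thesis
  proof (cases "onorm P = 0")
    case True
    with *[OF subspace_0[OF V0]] show ?thesis
      by simp
  next
    case False
    then have pos: "0 < onorm P"
      using onorm_pos_le[OF P(1)] by simp
    have "min_dist (V0 \<inter> U) u / onorm P \<le> quotient_norm V0 (canonical_surj V0 u)"
      using * pos by (intro le_quotient_norm[OF V0]) (simp add: field_simps)
    with pos show ?thesis
      by (simp add: field_simps)
  qed
qed

text \<open>
  Subtracting from \<open>u\<close> its nearest point in \<open>V0 \<inter> U\<close> gives a lift in \<open>U\<close> of the coset of \<open>u\<close>
  whose norm is the distance from \<open>u\<close> to \<open>V0 \<inter> U\<close>.
\<close>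

lemma minimal_lift:
  fixes V0 U :: "'a::real_inner set"
  assumes V0: "subspace V0" and U: "finite_dim_subspace U" and u: "u \<in> U"
  obtains u' where "u' \<in> U" "canonical_surj V0 u' = canonical_surj V0 u"
    "norm u' = min_dist (V0 \<inter> U) u"
proof -
  obtain w where w: "w \<in> V0 \<inter> U" "min_dist (V0 \<inter> U) u = norm (u - w)"
    using min_dist_attained[OF finite_dim_subspace_Int[OF V0 U], of u] by blast
  have "u - w \<in> U"
    using w u U by (auto simp: finite_dim_subspace_def subspace_diff)
  moreover have "canonical_surj V0 (u - w) = canonical_surj V0 u"
    using w subspace_neg[OF V0] by (simp add: canonical_surj_eq_iff[OF V0])
  ultimately show ?thesis
    using w that by simp
qed

section \<open>Splitting norms\<close>

lemma splitting_norm_sq_le: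
  assumes "(\<Sum>i=1..n. w i) = u" "\<And>i. i \<in> {1..n} \<Longrightarrow> w i \<in> S i"
  shows "(splitting_norm N n S u)\<^sup>2 \<le> (\<Sum>i=1..n. (N (w i))\<^sup>2)"
proof -
  have "(splitting_norm N n S u)\<^sup>2 =
      Inf {\<Sum>i=1..n. (N (w i))\<^sup>2 | w. (\<Sum>i=1..n. w i) = u \<and> (\<forall>i\<in>{1..n}. w i \<in> S i)}"
    using assms by (intro splitting_norm_sq) blast
  also have "\<dots> \<le> (\<Sum>i=1..n. (N (w i))\<^sup>2)"
    using assms by (intro cInf_lower) (auto intro!: bdd_belowI[of _ 0] sum_nonneg)
  finally show ?thesis .
qed

lemma le_splitting_norm_sq:
  assumes "\<exists>w. (\<Sum>i=1..n. w i) = u \<and> (\<forall>i\<in>{1..n}. w i \<in> S i)"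
    and "\<And>w. \<lbrakk>(\<Sum>i=1..n. w i) = u; \<And>i. i \<in> {1..n} \<Longrightarrow> w i \<in> S i\<rbrakk>
      \<Longrightarrow> c \<le> (\<Sum>i=1..n. (N (w i))\<^sup>2)"
  shows "c \<le> (splitting_norm N n S u)\<^sup>2"
  unfolding splitting_norm_sq[OF assms(1)] using assms
  by (intro cInf_greatest) auto

text \<open>The canonical surjection does not increase splitting norms.\<close>

lemma splitting_norm_canonical_surj_le:
  assumes n: "1 \<le> n" and V0: "subspace V0" and u: "u \<in> (\<Sum>i=1..n. V i)"
  shows "(splitting_norm (quotient_norm V0) n (\<lambda>i. canonical_surj V0 ` V i)
      (canonical_surj V0 u))\<^sup>2 \<le> (splitting_norm norm n V u)\<^sup>2"
proof (rule le_splitting_norm_sq)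
  show "\<exists>w. (\<Sum>i=1..n. w i) = u \<and> (\<forall>i\<in>{1..n}. w i \<in> V i)"
    using u by (simp only: mem_set_sum_iff[OF finite_atLeastAtMost])
next
  fix w assume w: "(\<Sum>i=1..n. w i) = u" "\<And>i. i \<in> {1..n} \<Longrightarrow> w i \<in> V i"
  have "(\<Sum>i=1..n. canonical_surj V0 (w i)) = canonical_surj V0 u"
    using n w(1) canonical_surj_sum[OF V0, of "{1..n}" w] by simp
  then have "(splitting_norm (quotient_norm V0) n (\<lambda>i. canonical_surj V0 ` V i)
      (canonical_surj V0 u))\<^sup>2 \<le> (\<Sum>i=1..n. (quotient_norm V0 (canonical_surj V0 (w i)))\<^sup>2)"
    using w(2) by (intro splitting_norm_sq_le) auto
  also have "\<dots> \<le> (\<Sum>i=1..n. (norm (w i))\<^sup>2)"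
    by (intro sum_mono power_mono quotient_norm_le_norm quotient_norm_nonneg[OF V0])
  finally show "(splitting_norm (quotient_norm V0) n (\<lambda>i. canonical_surj V0 ` V i)
      (canonical_surj V0 u))\<^sup>2 \<le> (\<Sum>i=1..n. (norm (w i))\<^sup>2)" .
qed

section \<open>Splittings of the quotient space\<close>

theorem theorem5p2:
  fixes n :: nat
    and V :: "nat \<Rightarrow> 'a::{real_inner, complete_space} set"
    and Vh V0 :: "'a set"
    and P :: "'a \<Rightarrow> 'a"
    and \<alpha> A :: real
    and \<kappa> :: "nat \<Rightarrow> real"
  assumes n: "1 \<le> n"
    and V: "\<forall>i\<in>{1..n}. finite_dim_subspace (V i)"
    and Vh: "Vh = (\<Sum>i=1..n. V i)"
    and V0: "subspace V0" "closed V0"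
    and const: "\<alpha> > 0" "A > 0"
    and equiv: "\<forall>u\<in>Vh. \<alpha> * (norm u)\<^sup>2 \<le> (splitting_norm norm n V u)\<^sup>2
                   \<and> (splitting_norm norm n V u)\<^sup>2 \<le> A * (norm u)\<^sup>2"
    and P_bounded: "bounded_linear P"
    and P_proj: "range P = Vh" "\<forall>u\<in>Vh. P u = u"
    and P_V0: "\<forall>v\<in>V0. P v \<in> V0"
    and \<kappa>_pos: "\<forall>i\<in>{1..n}. \<kappa> i > 0"
    and \<kappa>: "\<forall>i\<in>{1..n}. \<forall>u\<in>V i. min_dist (V0 \<inter> V i) u \<le> \<kappa> i * min_dist (V0 \<inter> Vh) u"
  shows "\<forall>f \<in> canonical_surj V0 ` Vh.
    \<alpha> / ((MAX i\<in>{1..n}. \<kappa> i)\<^sup>2 * (onorm P)\<^sup>2) * (quotient_norm V0 f)\<^sup>2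
      \<le> (splitting_norm (quotient_norm V0) n (\<lambda>i. canonical_surj V0 ` V i) f)\<^sup>2
    \<and> (splitting_norm (quotient_norm V0) n (\<lambda>i. canonical_surj V0 ` V i) f)\<^sup>2
      \<le> (onorm P)\<^sup>2 * A * (quotient_norm V0 f)\<^sup>2"
proof
  fix f assume f: "f \<in> canonical_surj V0 ` Vh"
  let ?T = "canonical_surj V0" and ?q = "quotient_norm V0"
  let ?N = "splitting_norm ?q n (\<lambda>i. ?T ` V i) f"
  define K where "K = (MAX i\<in>{1..n}. \<kappa> i)"
  obtain u where u: "u \<in> Vh" "f = ?T u"
    using f by blast
  have fd_Vh: "finite_dim_subspace Vh"
    unfolding Vh using V by (intro finite_dim_subspace_sum) auto
  have Vh_iff: "v \<in> Vh \<longleftrightarrow> (\<exists>w. (\<Sum>i=1..n. w i) = v \<and> (\<forall>i\<in>{1..n}. w i \<in> V i))" for v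
    unfolding Vh by (rule mem_set_sum_iff) simp
  have V_sub: "V i \<subseteq> Vh" if i: "i \<in> {1..n}" for i
  proof
    fix x assume x: "x \<in> V i"
    have "0 \<in> V j" if "j \<in> {1..n}" for j
      using V that by (auto simp: finite_dim_subspace_def subspace_0)
    with x i show "x \<in> Vh"
      unfolding Vh_iff by (intro exI[of _ "\<lambda>j. if j = i then x else 0"]) auto
  qed
  have T_sum: "?T (\<Sum>i=1..n. w i) = (\<Sum>i=1..n. ?T (w i))" for w
    using n by (intro canonical_surj_sum[OF V0(1)]) auto
  have md: "min_dist (V0 \<inter> Vh) v \<le> onorm P * ?q (?T v)" if "v \<in> Vh" for v
    using that P_proj P_V0
    by (intro min_dist_le_quotient_norm[OF V0(1) finite_dim_subspace_Int[OF V0(1) fd_Vh] P_bounded])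
      auto
  have P_nonneg: "0 \<le> onorm P"
    by (rule onorm_pos_le[OF P_bounded])

  have upper: "?N\<^sup>2 \<le> (onorm P)\<^sup>2 * A * (?q f)\<^sup>2"
  proof -
    obtain u' where u': "u' \<in> Vh" "?T u' = f" "norm u' = min_dist (V0 \<inter> Vh) u"
      using minimal_lift[OF V0(1) fd_Vh u(1)] u(2) by metis
    have "?N\<^sup>2 \<le> (splitting_norm norm n V u')\<^sup>2"
      using splitting_norm_canonical_surj_le[OF n V0(1)] u' Vh by blast
    also have "\<dots> \<le> A * (norm u')\<^sup>2"
      using equiv u'(1) by blast
    also have "\<dots> \<le> A * (onorm P * ?q f)\<^sup>2"
      using const md[OF u(1)] u(2) by (intro mult_left_mono power_mono) (auto simp: u'(3)[symmetric])
    finally show ?thesis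
      by (simp add: power_mult_distrib mult_ac)
  qed

  have split_bound: "\<alpha> * (?q f)\<^sup>2 \<le> K\<^sup>2 * (onorm P)\<^sup>2 * (\<Sum>i=1..n. (?q (g i))\<^sup>2)"
    if g: "(\<Sum>i=1..n. g i) = f" "\<And>i. i \<in> {1..n} \<Longrightarrow> g i \<in> ?T ` V i" for g
  proof -
    have "\<exists>x. x \<in> V i \<and> ?T x = g i \<and> norm x \<le> K * onorm P * ?q (g i)"
      if i: "i \<in> {1..n}" for i
    proof -
      obtain v where v: "v \<in> V i" "g i = ?T v"
        using g(2)[OF i] by blast
      obtain x where x: "x \<in> V i" "?T x = ?T v" "norm x = min_dist (V0 \<inter> V i) v"
        using minimal_lift[OF V0(1) _ v(1)] V i by metis
      have \<kappa>_le: "0 \<le> \<kappa> i" "\<kappa> i \<le> K"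
        using i \<kappa>_pos by (auto simp: K_def intro!: less_imp_le)
      have q_nonneg: "0 \<le> ?q (?T v)"
        by (rule quotient_norm_nonneg[OF V0(1)])
      have "norm x \<le> \<kappa> i * min_dist (V0 \<inter> Vh) v"
        using \<kappa> i v(1) x(3) by auto
      also have "\<dots> \<le> \<kappa> i * (onorm P * ?q (?T v))"
        using md V_sub[OF i] v(1) \<kappa>_le by (intro mult_left_mono) auto
      also have "\<dots> \<le> K * (onorm P * ?q (?T v))"
        using \<kappa>_le P_nonneg q_nonneg by (intro mult_right_mono) auto
      finally show ?thesis
        using x v(2) by (auto simp: mult.assoc)
    qed
    then obtain x where x: "\<And>i. i \<in> {1..n} \<Longrightarrow> x i \<in> V i \<and> ?T (x i) = g i
        \<and> norm (x i) \<le> K * onorm P * ?q (g i)"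
      by metis
    define v where "v = (\<Sum>i=1..n. x i)"
    have v: "v \<in> Vh"
      using x unfolding Vh_iff v_def by blast
    have Tv: "?T v = f"
      unfolding v_def T_sum g(1)[symmetric] using x by (intro sum.cong) auto
    have "\<alpha> * (?q f)\<^sup>2 \<le> \<alpha> * (norm v)\<^sup>2"
      unfolding Tv[symmetric] using const
      by (intro mult_left_mono power_mono quotient_norm_le_norm quotient_norm_nonneg[OF V0(1)]) auto
    also have "\<dots> \<le> (splitting_norm norm n V v)\<^sup>2"
      using equiv v by blast
    also have "\<dots> \<le> (\<Sum>i=1..n. (norm (x i))\<^sup>2)"
      using x by (intro splitting_norm_sq_le) (auto simp: v_def)
    also have "\<dots> \<le> (\<Sum>i=1..n. (K * onorm P * ?q (g i))\<^sup>2)"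
      using x by (intro sum_mono power_mono) auto
    also have "\<dots> = K\<^sup>2 * (onorm P)\<^sup>2 * (\<Sum>i=1..n. (?q (g i))\<^sup>2)"
      by (simp add: power_mult_distrib sum_distrib_left)
    finally show ?thesis .
  qed

  have lower: "\<alpha> / (K\<^sup>2 * (onorm P)\<^sup>2) * (?q f)\<^sup>2 \<le> ?N\<^sup>2"
  proof (cases "K\<^sup>2 * (onorm P)\<^sup>2 = 0")
    \<comment> \<open>If \<open>P = 0\<close>, the quotient on the left is \<open>0\<close> by the convention on division by zero.\<close>
    case True
    show ?thesis
      unfolding True by simp
  next
    case False
    then have pos: "0 < K\<^sup>2 * (onorm P)\<^sup>2"
      by (metis mult_nonneg_nonneg order_le_less zero_le_power2)
    show ?thesis
    proof (rule le_splitting_norm_sq)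
      obtain w where "(\<Sum>i=1..n. w i) = u" "\<forall>i\<in>{1..n}. w i \<in> V i"
        using u(1) Vh_iff by blast
      then show "\<exists>g. (\<Sum>i=1..n. g i) = f \<and> (\<forall>i\<in>{1..n}. g i \<in> ?T ` V i)"
        using T_sum[of w] u(2) by (intro exI[of _ "\<lambda>i. ?T (w i)"]) auto
    next
      fix g assume "(\<Sum>i=1..n. g i) = f" "\<And>i. i \<in> {1..n} \<Longrightarrow> g i \<in> ?T ` V i"
      from split_bound[OF this] pos
      show "\<alpha> / (K\<^sup>2 * (onorm P)\<^sup>2) * (?q f)\<^sup>2 \<le> (\<Sum>i=1..n. (?q (g i))\<^sup>2)"
        by (simp add: field_simps)
    qed
  qed

  from lower upper show "\<alpha> / ((MAX i\<in>{1..n}. \<kappa> i)\<^sup>2 * (onorm P)\<^sup>2) * (?q f)\<^sup>2 \<le> ?N\<^sup>2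
      \<and> ?N\<^sup>2 \<le> (onorm P)\<^sup>2 * A * (?q f)\<^sup>2"
    unfolding K_def by blast
qed

end
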